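(* Let $P\in\mathbb{D}\mathbb{H}[t]$ be a generic motion polynomial of degree $n>0$. Then there exist rotation quaternions $h_1,\dots,h_n\in\mathbb{D}\mathbb{H}$ such that $P(t)=(t-h_1)(t-h_2)\cdots(t-h_n)$.
   Context: Let $\mathbb{D}=\mathbb{R}+\epsilon\mathbb{R}$ with $\epsilon^2=0$ be the ring of dual numbers, $\mathbb{H}$ the real quaternions, and $\mathbb{D}\mathbb{H}$ the algebra of quaternions with coefficients in $\mathbb{D}$ ($\epsilon$ is central). Each $h\in\mathbb{D}\mathbb{H}$ is written $h=p+\epsilon q$ with $p,q\in\mathbb{H}$; $p$ is the primal part and $q$ the dual part. The conjugate $\overline{h}$ is obtained by multiplying the vectorial part (the $\mathbf{i},\mathbf{j},\mathbf{k}$ components, in $\mathbb{D}^3$) of $h$ by $-1$. The norm $h\overline{h}$ and trace $h+\overline{h}$ lie in $\mathbb{D}$. A nonzero dual quaternion $h=p+\epsilon q$ is called a rotation quaternion (it represents a rotation) if $h\overline{h}\in\mathbb{R}$, $h+\overline{h}\in\mathbb{R}$ and $p\notin\mathbb{R}$. $\mathbb{D}\mathbb{H}[t]$ is the ring of polynomials over $\mathbb{D}\mathbb{H}$ in which the indeterminate $t$ commutes with all coefficients; for $P=\sum a_it^i$ put $\overline{P}=\sum\overline{a_i}t^i$. A motion polynomial is a monic $P\in\mathbb{D}\mathbb{H}[t]$ with $P\overline{P}\in\mathbb{R}[t]$. A motion polynomial $P$ of degree $n>0$ is generic if $P\overline{P}$ has $n$ distinct monic quadratic factors that are irreducible over $\mathbb{R}$,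 i.e. $P\overline{P}=M_1\cdots M_n$ with pairwise distinct monic irreducible quadratic $M_i\in\mathbb{R}[t]$. *)

theory Defs
  imports
    Complex_Main
    "HOL-Library.Poly_Mapping"
    "HOL-Computational_Algebra.Polynomial"
begin

section \<open>Dual numbers\<close>

codatatype dual_number = Dual (Prim: real) (Eps: real)

lemma dual_number_eq_iff: "x = y \<longleftrightarrow> Prim x = Prim y \<and> Eps x = Eps y"
  by (auto intro: dual_number.expand)

instantiation dual_number :: comm_ring_1
begin

primcorec zero_dual_number where
  "Prim 0 = 0"
| "Eps 0 = 0"

primcorec one_dual_number where
  "Prim 1 = 1"
| "Eps 1 = 0"

primcorec plus_dual_number where
  "Prim (x + y) = Prim x + Prim y"
| "Eps (x + y) = Eps x + Eps y"

primcorec uminus_dual_number where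
  "Prim (- x) = - Prim x"
| "Eps (- x) = - Eps x"

primcorec minus_dual_number where
  "Prim (x - y) = Prim x - Prim y"
| "Eps (x - y) = Eps x - Eps y"

primcorec times_dual_number where
  "Prim (x * y) = Prim x * Prim y"
| "Eps (x * y) = Prim x * Eps y + Eps x * Prim y"

instance
  by standard (simp_all add: dual_number_eq_iff algebra_simps)

end

instantiation dual_number :: real_algebra_1
begin

primcorec scaleR_dual_number where
  "Prim (scaleR r x) = r * Prim x"
| "Eps (scaleR r x) = r * Eps x"

instance
  by standard (simp_all add: dual_number_eq_iff algebra_simps)

end

lemma eps_squared: "Dual 0 1 * Dual 0 1 = 0"
  by (simp add: dual_number_eq_iff)

lemma dual_number_decomp: "x = of_real (Prim x) + Dual 0 1 * of_real (Eps x)"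
  by (simp add: dual_number_eq_iff of_real_def)


section \<open>Quaternions over a commutative ring\<close>

codatatype 'a quat = Quat (Q1: 'a) (QI: 'a) (QJ: 'a) (QK: 'a)

lemma quat_eq_iff:
  "x = y \<longleftrightarrow> Q1 x = Q1 y \<and> QI x = QI y \<and> QJ x = QJ y \<and> QK x = QK y"
  by (auto intro: quat.expand)

instantiation quat :: (comm_ring_1) ring_1
begin

primcorec zero_quat :: "'a quat" where
  "Q1 0 = 0"
| "QI 0 = 0"
| "QJ 0 = 0"
| "QK 0 = 0"

primcorec one_quat :: "'a quat" where
  "Q1 1 = 1"
| "QI 1 = 0"
| "QJ 1 = 0"
| "QK 1 = 0"

primcorec plus_quat :: "'a quat \<Rightarrow> 'a quat \<Rightarrow> 'a quat" where
  "Q1 (x + y) = Q1 x + Q1 y"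
| "QI (x + y) = QI x + QI y"
| "QJ (x + y) = QJ x + QJ y"
| "QK (x + y) = QK x + QK y"

primcorec uminus_quat :: "'a quat \<Rightarrow> 'a quat" where
  "Q1 (- x) = - Q1 x"
| "QI (- x) = - QI x"
| "QJ (- x) = - QJ x"
| "QK (- x) = - QK x"

primcorec minus_quat :: "'a quat \<Rightarrow> 'a quat \<Rightarrow> 'a quat" where
  "Q1 (x - y) = Q1 x - Q1 y"
| "QI (x - y) = QI x - QI y"
| "QJ (x - y) = QJ x - QJ y"
| "QK (x - y) = QK x - QK y"

primcorec times_quat :: "'a quat \<Rightarrow> 'a quat \<Rightarrow> 'a quat" where
  "Q1 (x * y) = Q1 x * Q1 y - QI x * QI y - QJ x * QJ y - QK x * QK y"
| "QI (x * y) = Q1 x * QI y + QI x * Q1 y + QJ x * QK y - QK x * QJ y"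
| "QJ (x * y) = Q1 x * QJ y - QI x * QK y + QJ x * Q1 y + QK x * QI y"
| "QK (x * y) = Q1 x * QK y + QI x * QJ y - QJ x * QI y + QK x * Q1 y"

instance
  by standard (simp_all add: quat_eq_iff algebra_simps)

end

instantiation quat :: ("{comm_ring_1, real_algebra_1}") real_algebra_1
begin

primcorec scaleR_quat :: "real \<Rightarrow> 'a quat \<Rightarrow> 'a quat" where
  "Q1 (scaleR r x) = scaleR r (Q1 x)"
| "QI (scaleR r x) = scaleR r (QI x)"
| "QJ (scaleR r x) = scaleR r (QJ x)"
| "QK (scaleR r x) = scaleR r (QK x)"

instance
  by standard (simp_all add: quat_eq_iff algebra_simps)

end

lemma quat_unit_relations:
  fixes i j k :: "'a :: comm_ring_1 quat"
  defines "i \<equiv> Quat 0 1 0 0" and "j \<equiv> Quat 0 0 1 0" and "k \<equiv> Quat 0 0 0 1"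
  shows "i * i = - 1" "j * j = - 1" "k * k = - 1" "i * j * k = - 1"
  by (simp_all add: quat_eq_iff i_def j_def k_def)

primcorec qcnj :: "'a :: comm_ring_1 quat \<Rightarrow> 'a quat" where
  "Q1 (qcnj x) = Q1 x"
| "QI (qcnj x) = - QI x"
| "QJ (qcnj x) = - QJ x"
| "QK (qcnj x) = - QK x"


section \<open>Dual quaternions\<close>

type_synonym dual_quat = "dual_number quat"

definition primal :: "dual_quat \<Rightarrow> real quat" where
  "primal h = map_quat Prim h"

text \<open>
  \<^term>\<open>\<real>\<close> is the canonical image of the reals in the respective real algebra: dual quaternions
  for the first two occurrences, real quaternions for the third.
\<close>

definition rotation_quat :: "dual_quat \<Rightarrow> bool" where
  "rotation_quat h \<longleftrightarrow> h \<noteq> 0 \<and> h * qcnj h \<in> \<real> \<and> h + qcnj h \<in> \<real> \<and> primal h \<notin> \<real>"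


section \<open>Polynomials over the dual quaternions\<close>

text \<open>
  Multiplication on \<^typ>\<open>'a poly\<close> is only available over commutative coefficients. The
  finitely supported maps \<^typ>\<open>nat \<Rightarrow>\<^sub>0 'a\<close> with their convolution product form the polynomial
  ring over an arbitrary ring, with an indeterminate that commutes with all coefficients.
\<close>

type_synonym dq_poly = "nat \<Rightarrow>\<^sub>0 dual_quat"

definition const_dqp :: "dual_quat \<Rightarrow> dq_poly" where
  "const_dqp h = Poly_Mapping.single 0 h"

definition indet_dqp :: dq_poly where
  "indet_dqp = Poly_Mapping.single 1 1"

lemma indet_commutes: "indet_dqp * const_dqp h = const_dqp h * indet_dqp"
  by (simp add: indet_dqp_def const_dqp_def mult_single)

text \<open>
  \<^const>\<open>Poly_Mapping.degree\<close> exceeds the usual degree of a nonzero polynomial by one.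
\<close>

definition degree_dqp :: "dq_poly \<Rightarrow> nat" where
  "degree_dqp P = (LEAST n. \<forall>i>n. Poly_Mapping.lookup P i = 0)"

definition monic_dqp :: "dq_poly \<Rightarrow> bool" where
  "monic_dqp P \<longleftrightarrow> Poly_Mapping.lookup P (degree_dqp P) = 1"

definition cnj_dqp :: "dq_poly \<Rightarrow> dq_poly" where
  "cnj_dqp P = Poly_Mapping.map qcnj P"

lift_definition dqp_of_real_poly :: "real poly \<Rightarrow> dq_poly" is
  "\<lambda>M n. of_real (poly.coeff M n)"
proof -
  fix M :: "real poly"
  show "finite {n. of_real (poly.coeff M n) \<noteq> (0 :: dual_quat)}"
    by (rule finite_subset[of _ "{..degree M}"]) (auto intro: le_degree)
qed

definition motion_poly :: "dq_poly \<Rightarrow> bool" where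
  "motion_poly P \<longleftrightarrow> monic_dqp P \<and> P * cnj_dqp P \<in> Set.range dqp_of_real_poly"

definition generic_motion_poly :: "dq_poly \<Rightarrow> bool" where
  "generic_motion_poly P \<longleftrightarrow>
     motion_poly P \<and> degree_dqp P > 0 \<and>
     (\<exists>S :: real poly set. finite S \<and> card S = degree_dqp P \<and>
        (\<forall>M\<in>S. lead_coeff M = 1 \<and> degree M = 2 \<and> irreducible M) \<and>
        P * cnj_dqp P = dqp_of_real_poly (\<Prod>S))"

end

theory Submission
  imports
    Defs
    "HOL-Computational_Algebra.Polynomial_Factorial"
begin

text \<open>
  Linear factors are split off on the right, one for each quadratic factor \<open>M\<close> of the norm
  polynomial \<open>P P\<^sup>*\<close>, where \<open>\<^sup>*\<close> is conjugation. Division by the central monic polynomial \<open>M\<close>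
  gives \<open>P = Q M + R\<close> with \<open>R = r\<^sub>1 t + r\<^sub>0\<close>. Since \<open>M\<close> divides \<open>P P\<^sup>*\<close>, it divides \<open>R R\<^sup>*\<close>, and
  comparing degrees gives \<open>R R\<^sup>* = (r\<^sub>1 r\<^sub>1\<^sup>*) M\<close> (\<open>remainder_norm\<close>).

  If \<open>r\<^sub>1\<close> has nonzero primal part, it is invertible, and \<open>h = - r\<^sub>1\<^sup>-\<^sup>1 r\<^sub>0\<close> satisfies
  \<open>R = r\<^sub>1 (t - h)\<close> and \<open>(t - h) (t - h\<^sup>*) = M = (t - h\<^sup>*) (t - h)\<close> (\<open>root_of_remainder\<close>). Hence
  \<open>t - h\<close> is a right factor of \<open>P\<close>, and the cofactor has norm polynomial \<open>P P\<^sup>* / M\<close>. The norm and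
  the trace of \<open>h\<close> are real because \<open>M\<close> is, and a real primal part \<open>p\<close> would make \<open>M\<close> equal to
  \<open>(t - p)\<^sup>2\<close>, which is reducible; so \<open>h\<close> is a rotation quaternion.

  Genericity excludes the other case (\<open>remainder_leading_nonzero\<close>). If the primal part of \<open>r\<^sub>1\<close>
  vanishes, then so does that of \<open>r\<^sub>0\<close>, because \<open>r\<^sub>0 r\<^sub>0\<^sup>*\<close> is a multiple of \<open>r\<^sub>1 r\<^sub>1\<^sup>* = 0\<close>. The primal
  part of \<open>P\<close> is then a multiple of \<open>M\<close>, and that of \<open>P P\<^sup>*\<close> a multiple of \<open>M\<^sup>2\<close>. But \<open>P P\<^sup>*\<close> is real,
  so \<open>M\<close> divides the product of the other quadratic factors, which are irreducible and distinct
  from \<open>M\<close>.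
\<close>


section \<open>Arithmetic of dual quaternions\<close>

lemma qcnj_simps [simp]:
  "qcnj 0 = 0" "qcnj 1 = 1" "qcnj (x + y) = qcnj x + qcnj y" "qcnj (- x) = - qcnj x"
  "qcnj (x - y) = qcnj x - qcnj y" "qcnj (x * y) = qcnj y * qcnj x" "qcnj (qcnj x) = x"
  by (simp_all add: quat_eq_iff algebra_simps)

lemma of_real_dual_number_sel [simp]:
  "Prim (of_real r) = r" "Eps (of_real r) = 0"
  by (simp_all add: of_real_def)

lemma of_real_quat_sel [simp]:
  fixes r :: real
  shows "Q1 (of_real r :: 'a :: {comm_ring_1, real_algebra_1} quat) = of_real r"
    "QI (of_real r :: 'a quat) = 0" "QJ (of_real r :: 'a quat) = 0" "QK (of_real r :: 'a quat) = 0"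
  by (simp_all add: of_real_def)

lemma qcnj_of_real [simp]: "qcnj (of_real r :: 'a :: {comm_ring_1, real_algebra_1} quat) = of_real r"
  by (simp add: quat_eq_iff)

lemma of_real_commute: "(of_real r :: 'a :: real_algebra_1) * x = x * of_real r"
  by (simp add: of_real_def)

lemma quat_norm_commute: "qcnj x * x = x * qcnj (x :: 'a :: comm_ring_1 quat)"
  by (simp add: quat_eq_iff algebra_simps)

lemma primal_sel [simp]:
  "Q1 (primal h) = Prim (Q1 h)" "QI (primal h) = Prim (QI h)"
  "QJ (primal h) = Prim (QJ h)" "QK (primal h) = Prim (QK h)"
  by (simp_all add: primal_def quat.map_sel)

lemma primal_mult: "primal (x * y) = primal x * primal y"
  by (simp add: quat_eq_iff)

lemma primal_zero [simp]: "primal 0 = 0"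
  by (simp add: quat_eq_iff)

text \<open>Two purely dual elements have product zero because \<open>\<epsilon>\<^sup>2 = 0\<close>.\<close>

lemma primal_zero_mult:
  assumes "primal x = 0" "primal y = 0"
  shows "x * y = 0"
  using assms by (simp add: quat_eq_iff dual_number_eq_iff)

lemma primal_qcnj_eq_0_iff [simp]: "primal (qcnj x) = 0 \<longleftrightarrow> primal x = 0"
  by (simp add: quat_eq_iff)

lemma primal_norm_eq_0:
  assumes "primal (x * qcnj x) = 0"
  shows "primal x = 0"
proof -
  have "(Prim (Q1 x))\<^sup>2 + (Prim (QI x))\<^sup>2 + (Prim (QJ x))\<^sup>2 + (Prim (QK x))\<^sup>2 = 0"
    using assms by (simp add: quat_eq_iff power2_eq_square)
  then show ?thesis
    by (simp add: quat_eq_iff add_nonneg_eq_0_iff)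
qed

lemma dual_number_invertible:
  assumes "Prim x \<noteq> 0"
  obtains y where "x * y = 1"
proof
  show "x * Dual (1 / Prim x) (- Eps x / (Prim x)\<^sup>2) = 1"
    using assms by (simp add: dual_number_eq_iff field_simps power2_eq_square)
qed

lemma dual_quat_invertible:
  fixes x :: dual_quat
  assumes "primal x \<noteq> 0"
  obtains y where "x * y = 1" "y * x = 1"
proof -
  have norm: "x * qcnj x = Quat (Q1 (x * qcnj x)) 0 0 0"
    by (simp add: quat_eq_iff algebra_simps)
  have "Prim (Q1 (x * qcnj x)) \<noteq> 0"
  proof
    assume "Prim (Q1 (x * qcnj x)) = 0"
    with norm have "primal (x * qcnj x) = 0"
      by (metis primal_sel quat.sel quat_eq_iff zero_dual_number.sel(1) zero_quat.sel)
    with assms show False using primal_norm_eq_0 by blast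
  qed
  then obtain z where z: "Q1 (x * qcnj x) * z = 1" by (rule dual_number_invertible)
  define y where "y = qcnj x * Quat z 0 0 0"
  have "x * y = Quat (Q1 (x * qcnj x)) 0 0 0 * Quat z 0 0 0"
    unfolding y_def using norm by (metis mult.assoc)
  also have "\<dots> = 1"
    by (subst quat_eq_iff) (use z in simp)
  finally have xy: "x * y = 1" .
  have "y * x = Quat z 0 0 0 * (qcnj x * x)"
    unfolding y_def by (simp add: quat_eq_iff algebra_simps)
  also have "\<dots> = Quat z 0 0 0 * Quat (Q1 (x * qcnj x)) 0 0 0"
    using norm by (metis quat_norm_commute)
  also have "\<dots> = 1"
    by (subst quat_eq_iff) (use z in \<open>simp add: mult.commute\<close>)
  finally have "y * x = 1" .
  with xy show thesis by (rule that)
qed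


section \<open>Polynomials with noncommuting coefficients\<close>

lemma dqp_induct [case_names single add]:
  fixes F :: "nat \<Rightarrow>\<^sub>0 'a :: comm_monoid_add"
  assumes single: "\<And>k a. Q (Poly_Mapping.single k a)"
    and add: "\<And>F G. Q F \<Longrightarrow> Q G \<Longrightarrow> Q (F + G)"
  shows "Q F"
proof (induction F rule: update_induct)
  case const
  show ?case using single[of 0 0] by simp
next
  case (update F k a)
  have "Poly_Mapping.update k a F = F + Poly_Mapping.single k a"
    by (rule poly_mapping_eqI)
      (use update in \<open>auto simp: lookup_update lookup_add lookup_single in_keys_iff when_def\<close>)
  then show ?case using single add update by simp
qed

lemma const_dqp_simps:
  "const_dqp 0 = 0" "const_dqp 1 = 1" "const_dqp (a + b) = const_dqp a + const_dqp b"
  "const_dqp (- a) = - const_dqp a" "const_dqp (a - b) = const_dqp a - const_dqp b"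
  "const_dqp (a * b) = const_dqp a * const_dqp b"
  by (simp_all add: const_dqp_def single_add single_uminus single_diff mult_single)

lemma lookup_const_dqp: "Poly_Mapping.lookup (const_dqp a) i = (if i = 0 then a else 0)"
  by (simp add: const_dqp_def lookup_single when_def)

lemma lookup_mult_const:
  "Poly_Mapping.lookup (F * const_dqp a) i = Poly_Mapping.lookup F i * a"
  by (induction F rule: dqp_induct)
    (simp_all add: const_dqp_def mult_single lookup_single when_def distrib_right lookup_add)

lemma lookup_mult_indet:
  "Poly_Mapping.lookup (F * indet_dqp) i = (case i of 0 \<Rightarrow> 0 | Suc j \<Rightarrow> Poly_Mapping.lookup F j)"
  by (induction F rule: dqp_induct)
    (auto simp: indet_dqp_def mult_single lookup_single when_def distrib_right lookup_add
      split: nat.split)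

lemma indet_commute: "indet_dqp * F = F * indet_dqp"
  by (induction F rule: dqp_induct)
    (simp_all add: indet_dqp_def mult_single distrib_left distrib_right)

lemma indet_const_commute:
  "indet_dqp * const_dqp a = const_dqp a * indet_dqp"
  "indet_dqp * (const_dqp a * F) = const_dqp a * (indet_dqp * F)"
  by (rule indet_commutes) (metis indet_commutes mult.assoc)

lemma single_Suc: "Poly_Mapping.single (Suc k) a = Poly_Mapping.single k a * indet_dqp"
  by (simp add: indet_dqp_def mult_single)

lemma lookup_cnj_dqp: "Poly_Mapping.lookup (cnj_dqp F) i = qcnj (Poly_Mapping.lookup F i)"
  by (simp add: cnj_dqp_def Poly_Mapping.map.rep_eq when_def)

lemma cnj_dqp_add [simp]: "cnj_dqp (F + G) = cnj_dqp F + cnj_dqp G"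
  by (rule poly_mapping_eqI) (simp add: lookup_cnj_dqp lookup_add)

lemma cnj_dqp_diff [simp]: "cnj_dqp (F - G) = cnj_dqp F - cnj_dqp G"
  by (rule poly_mapping_eqI) (simp add: lookup_cnj_dqp lookup_minus)

lemma cnj_dqp_single: "cnj_dqp (Poly_Mapping.single k a) = Poly_Mapping.single k (qcnj a)"
  by (rule poly_mapping_eqI) (simp add: lookup_cnj_dqp lookup_single when_def)

lemma cnj_dqp_const [simp]: "cnj_dqp (const_dqp a) = const_dqp (qcnj a)"
  by (simp add: const_dqp_def cnj_dqp_single)

lemma cnj_dqp_indet [simp]: "cnj_dqp indet_dqp = indet_dqp"
  by (simp add: indet_dqp_def cnj_dqp_single)

lemma cnj_dqp_mult [simp]: "cnj_dqp (F * G) = cnj_dqp G * cnj_dqp F"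
proof (induction F rule: dqp_induct)
  case (single k a)
  show ?case
    by (induction G rule: dqp_induct)
      (simp_all add: cnj_dqp_single mult_single distrib_left distrib_right add.commute)
qed (simp add: distrib_left distrib_right)

text \<open>
  This replaces degree arguments: it suffices to show that each coefficient vanishes provided that
  all later ones do.
\<close>

lemma lookup_eq_0_descending:
  fixes F :: "nat \<Rightarrow>\<^sub>0 'a :: zero"
  assumes "\<And>i. m \<le> i \<Longrightarrow> \<forall>j>i. Poly_Mapping.lookup F j = 0 \<Longrightarrow> Poly_Mapping.lookup F i = 0"
    and "m \<le> i"
  shows "Poly_Mapping.lookup F i = 0"
proof (rule ccontr)
  assume nz: "Poly_Mapping.lookup F i \<noteq> 0"
  define j where "j = Max (Poly_Mapping.keys F)"
  have "i \<in> Poly_Mapping.keys F" using nz by (simp add: in_keys_iff)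
  then have "j \<in> Poly_Mapping.keys F" "i \<le> j" unfolding j_def by (auto intro: Max_in)
  moreover have "\<forall>l>j. Poly_Mapping.lookup F l = 0"
    unfolding j_def by (metis Max_ge finite_keys in_keys_iff linorder_not_le)
  ultimately show False using assms by (metis in_keys_iff le_trans)
qed

lemma lookup_mult_linear:
  "Poly_Mapping.lookup (F * (indet_dqp - const_dqp h)) (Suc i) =
     Poly_Mapping.lookup F i - Poly_Mapping.lookup F (Suc i) * h"
  by (simp add: right_diff_distrib lookup_minus lookup_mult_indet lookup_mult_const)

section \<open>Real polynomials as central elements\<close>

lemma dqp_of_real_poly_0 [simp]: "dqp_of_real_poly 0 = 0"
  by (rule poly_mapping_eqI) (simp add: dqp_of_real_poly.rep_eq)

lemma dqp_of_real_poly_add: "dqp_of_real_poly (M + N) = dqp_of_real_poly M + dqp_of_real_poly N"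
  by (rule poly_mapping_eqI) (simp add: dqp_of_real_poly.rep_eq lookup_add)

lemma dqp_of_real_poly_pCons:
  "dqp_of_real_poly (pCons a M) = const_dqp (of_real a) + dqp_of_real_poly M * indet_dqp"
  by (rule poly_mapping_eqI)
    (simp add: dqp_of_real_poly.rep_eq lookup_add lookup_const_dqp lookup_mult_indet coeff_pCons
      split: nat.split)

lemma dqp_of_real_poly_smult:
  "dqp_of_real_poly (smult a M) = dqp_of_real_poly M * const_dqp (of_real a)"
  by (rule poly_mapping_eqI)
    (simp add: dqp_of_real_poly.rep_eq lookup_mult_const mult.commute flip: of_real_mult)

lemma const_of_real_commute: "const_dqp (of_real a) * F = F * const_dqp (of_real a)"
  by (induction F rule: dqp_induct)
    (simp_all add: const_dqp_def mult_single distrib_left distrib_right of_real_commute)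

lemma dqp_of_real_poly_commute: "dqp_of_real_poly M * F = F * dqp_of_real_poly M"
proof (induction M)
  case (pCons a M)
  have "dqp_of_real_poly M * indet_dqp * F = dqp_of_real_poly M * F * indet_dqp"
    by (simp add: mult.assoc indet_commute)
  also have "\<dots> = F * (dqp_of_real_poly M * indet_dqp)"
    by (simp add: pCons.IH mult.assoc)
  finally show ?case
    by (simp add: dqp_of_real_poly_pCons distrib_left distrib_right const_of_real_commute)
qed simp

lemma dqp_of_real_poly_mult: "dqp_of_real_poly (M * N) = dqp_of_real_poly M * dqp_of_real_poly N"
proof (induction M)
  case (pCons a M)
  have "dqp_of_real_poly (pCons a M * N) =
      dqp_of_real_poly N * const_dqp (of_real a)
      + dqp_of_real_poly M * (dqp_of_real_poly N * indet_dqp)"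
    by (simp add: dqp_of_real_poly_add dqp_of_real_poly_smult dqp_of_real_poly_pCons const_dqp_simps
        pCons.IH mult.assoc)
  then show ?case
    by (simp add: dqp_of_real_poly_pCons distrib_right const_of_real_commute mult.assoc indet_commute)
qed simp

lemma cnj_dqp_of_real_poly [simp]: "cnj_dqp (dqp_of_real_poly M) = dqp_of_real_poly M"
  by (rule poly_mapping_eqI) (simp add: lookup_cnj_dqp dqp_of_real_poly.rep_eq)

text \<open>Real quadratics are kept in the form \<^term>\<open>[:c, b, 1:]\<close>, that is \<open>t\<^sup>2 + b t + c\<close>.\<close>

lemma dqp_of_real_poly_quadratic:
  "dqp_of_real_poly [:c, b, 1:] =
     indet_dqp * indet_dqp + const_dqp (of_real b) * indet_dqp + const_dqp (of_real c)"
  by (simp add: dqp_of_real_poly_pCons const_dqp_simps distrib_right add_ac)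

lemma lookup_mult_quadratic:
  "Poly_Mapping.lookup (F * dqp_of_real_poly [:c, b, 1:]) i =
     (if i < 2 then 0 else Poly_Mapping.lookup F (i - 2)) +
     (if i < 1 then 0 else Poly_Mapping.lookup F (i - 1)) * of_real b +
     Poly_Mapping.lookup F i * of_real c"
  unfolding dqp_of_real_poly_quadratic distrib_left mult.assoc[symmetric]
  by (auto simp: lookup_add lookup_mult_indet lookup_mult_const numeral_2_eq_2 split: nat.split)

lemma quadratic_conj_factor:
  assumes "h + qcnj h = - of_real b" "h * qcnj h = of_real c"
  shows "(indet_dqp - const_dqp h) * (indet_dqp - const_dqp (qcnj h)) = dqp_of_real_poly [:c, b, 1:]"
proof -
  have "(indet_dqp - const_dqp h) * (indet_dqp - const_dqp (qcnj h)) =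
      indet_dqp * indet_dqp - const_dqp (h + qcnj h) * indet_dqp + const_dqp (h * qcnj h)"
    by (simp add: algebra_simps const_dqp_simps indet_const_commute)
  then show ?thesis
    by (simp only: assms dqp_of_real_poly_quadratic const_dqp_simps) simp
qed

lemma divide_quadratic:
  obtains Q r1 r0 where
    "F = Q * dqp_of_real_poly [:c, b, 1:] + const_dqp r1 * indet_dqp + const_dqp r0"
proof -
  let ?M = "dqp_of_real_poly [:c, b, 1:]"
  define good where "good F \<longleftrightarrow>
    (\<exists>Q r1 r0. F = Q * ?M + const_dqp r1 * indet_dqp + const_dqp r0)" for F
  have tt: "indet_dqp * indet_dqp = ?M - const_dqp (of_real b) * indet_dqp - const_dqp (of_real c)"
    by (simp add: dqp_of_real_poly_quadratic)
  have shift: "good (G * indet_dqp)" if "good G" for G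
  proof -
    from that obtain Q r1 r0 where G: "G = Q * ?M + const_dqp r1 * indet_dqp + const_dqp r0"
      unfolding good_def by blast
    have "G * indet_dqp =
        Q * indet_dqp * ?M + const_dqp r1 * (indet_dqp * indet_dqp) + const_dqp r0 * indet_dqp"
      by (simp add: G distrib_right mult.assoc dqp_of_real_poly_commute)
    also have "\<dots> = (Q * indet_dqp + const_dqp r1) * ?M
        + const_dqp (r0 - r1 * of_real b) * indet_dqp + const_dqp (- (r1 * of_real c))"
      unfolding tt by (simp add: algebra_simps const_dqp_simps)
    finally show ?thesis unfolding good_def by blast
  qed
  have "good F"
  proof (induction F rule: dqp_induct)
    case (single k a)
    show ?case
    proof (induction k)
      case 0
      have "Poly_Mapping.single 0 a = 0 * ?M + const_dqp 0 * indet_dqp + const_dqp a"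
        by (simp add: const_dqp_def)
      then show ?case unfolding good_def by blast
    next
      case (Suc k)
      then show ?case by (simp add: single_Suc shift)
    qed
  next
    case (add F G)
    then obtain Q r1 r0 Q' r1' r0' where
      "F = Q * ?M + const_dqp r1 * indet_dqp + const_dqp r0"
      "G = Q' * ?M + const_dqp r1' * indet_dqp + const_dqp r0'"
      unfolding good_def by blast
    then have "F + G = (Q + Q') * ?M + const_dqp (r1 + r1') * indet_dqp + const_dqp (r0 + r0')"
      by (simp add: algebra_simps const_dqp_simps)
    then show ?case unfolding good_def by blast
  qed
  then show thesis using that unfolding good_def by blast
qed

lemma mult_quadratic_eq_0:
  assumes "F * dqp_of_real_poly [:c, b, 1:] = 0"
  shows "F = 0"
proof (rule poly_mapping_eqI)
  fix i
  have "Poly_Mapping.lookup F i = 0" if "\<forall>j>i. Poly_Mapping.lookup F j = 0" for i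
    using lookup_mult_quadratic[of F c b "i + 2"] assms that by simp
  then show "Poly_Mapping.lookup F i = Poly_Mapping.lookup 0 i"
    using lookup_eq_0_descending[of 0 F i] by simp
qed

text \<open>
  The real part of the primal part, taken coefficientwise. It is linear over the real polynomials,
  fixes them, and kills purely dual polynomials, so divisibility in the noncommutative ring can be
  read off in \<^typ>\<open>real poly\<close>.
\<close>

definition real_part_dqp :: "dq_poly \<Rightarrow> real poly" where
  "real_part_dqp F = Abs_poly (\<lambda>i. Prim (Q1 (Poly_Mapping.lookup F i)))"

lemma coeff_real_part_dqp: "coeff (real_part_dqp F) i = Prim (Q1 (Poly_Mapping.lookup F i))"
proof -
  have "Poly_Mapping.lookup F j = 0" if "Max (Poly_Mapping.keys F) < j" for j
    using that by (metis Max_ge finite_keys in_keys_iff linorder_not_le)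
  then show ?thesis unfolding real_part_dqp_def
    by (subst coeff_Abs_poly[of "Max (Poly_Mapping.keys F)"]) auto
qed

lemma real_part_dqp_of_real_poly [simp]: "real_part_dqp (dqp_of_real_poly M) = M"
  by (rule poly_eqI) (simp add: coeff_real_part_dqp dqp_of_real_poly.rep_eq)

lemma real_part_dqp_add: "real_part_dqp (F + G) = real_part_dqp F + real_part_dqp G"
  by (rule poly_eqI) (simp add: coeff_real_part_dqp lookup_add)

lemma real_part_dqp_cnj: "real_part_dqp (cnj_dqp F) = real_part_dqp F"
  by (rule poly_eqI) (simp add: coeff_real_part_dqp lookup_cnj_dqp)

lemma real_part_dqp_mult_real:
  "real_part_dqp (F * dqp_of_real_poly M) = real_part_dqp F * M"
proof (induction M arbitrary: F)
  case 0
  show ?case by (simp add: poly_eq_iff coeff_real_part_dqp)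
next
  case (pCons a M)
  have const: "real_part_dqp (F * const_dqp (of_real a)) = smult a (real_part_dqp F)"
    by (rule poly_eqI) (simp add: coeff_real_part_dqp lookup_mult_const)
  have indet: "real_part_dqp (F * indet_dqp) = pCons 0 (real_part_dqp F)" for F
    by (rule poly_eqI)
      (simp add: coeff_real_part_dqp lookup_mult_indet coeff_pCons split: nat.split)
  have "real_part_dqp (F * dqp_of_real_poly (pCons a M)) =
      real_part_dqp (F * const_dqp (of_real a)) + real_part_dqp (F * dqp_of_real_poly M * indet_dqp)"
    by (simp add: dqp_of_real_poly_pCons distrib_left real_part_dqp_add mult.assoc)
  then show ?case by (simp add: const indet pCons.IH mult_pCons_right)
qed


section \<open>Splitting off a linear factor\<close>

lemma quadratic_coeffs:
  assumes "lead_coeff M = 1" "degree M = 2"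
  obtains b c where "M = [:c, b, 1 :: real:]"
proof
  show "M = [:coeff M 0, coeff M 1, 1:]"
    using assms by (auto simp: poly_eq_iff coeff_pCons coeff_eq_0 numeral_2_eq_2 split: nat.split)
qed

lemma monic_irreducible_not_dvd_prod:
  fixes M :: "real poly"
  assumes "finite S" "\<And>N. N \<in> S \<Longrightarrow> lead_coeff N = 1 \<and> degree N = 2 \<and> irreducible N"
    and M: "lead_coeff M = 1" "degree M = 2" "irreducible M" "M \<notin> S"
  shows "\<not> M dvd \<Prod>S"
proof
  assume "M dvd \<Prod>S"
  moreover have "prime_elem M" using M(3) by (rule field_poly_irreducible_imp_prime)
  ultimately obtain N where N: "N \<in> S" "M dvd N"
    using assms(1) by (auto simp: prod_unfold_prod_mset elim: prime_elem_dvd_prod_msetE)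
  then obtain K where K: "N = M * K" by blast
  have "degree N = 2" "lead_coeff N = 1" using assms(2)[OF N(1)] by auto
  with K M have "K \<noteq> 0" by auto
  have "M \<noteq> 0" using M(2) by auto
  then have "degree K = 0"
    using K \<open>K \<noteq> 0\<close> M(2) \<open>degree N = 2\<close> by (simp add: degree_mult_eq)
  then obtain k where k: "K = [:k:]" by (rule degree_eq_zeroE)
  have "lead_coeff K = 1"
    using \<open>lead_coeff N = 1\<close> M(1) unfolding K lead_coeff_mult by simp
  with k have "k = 1" by simp
  with K k have "N = M" by simp
  with N M(4) show False by simp
qed

text \<open>
  The three equations express \<open>R R\<^sup>* = (r\<^sub>1 r\<^sub>1\<^sup>*) M\<close> for the remainder \<open>R = r\<^sub>1 t + r\<^sub>0\<close>: the first two compare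
  the lower coefficients, and the third identifies the quotient of \<open>R R\<^sup>*\<close> by \<open>M\<close>, computed from
  \<open>(Q M + R) (Q M + R)\<^sup>* = M N\<close>.
\<close>

lemma remainder_norm:
  assumes norm: "P * cnj_dqp P = dqp_of_real_poly ([:c, b, 1:] * N)"
    and P: "P = Q * dqp_of_real_poly [:c, b, 1:] + const_dqp r1 * indet_dqp + const_dqp r0"
  shows "r1 * qcnj r0 + r0 * qcnj r1 = r1 * qcnj r1 * of_real b"
    and "r0 * qcnj r0 = r1 * qcnj r1 * of_real c"
    and "dqp_of_real_poly N - Q * cnj_dqp Q * dqp_of_real_poly [:c, b, 1:]
      - Q * cnj_dqp (const_dqp r1 * indet_dqp + const_dqp r0)
      - (const_dqp r1 * indet_dqp + const_dqp r0) * cnj_dqp Q = const_dqp (r1 * qcnj r1)"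
proof -
  let ?M = "dqp_of_real_poly [:c, b, 1:]"
  define R where "R = const_dqp r1 * indet_dqp + const_dqp r0"
  define X where "X = dqp_of_real_poly N - Q * cnj_dqp Q * ?M - Q * cnj_dqp R - R * cnj_dqp Q"
  have comm: "?M * F = F * ?M" for F by (rule dqp_of_real_poly_commute)
  have "P = Q * ?M + R" by (simp add: P R_def add.assoc)
  moreover from this have "cnj_dqp P = cnj_dqp Q * ?M + cnj_dqp R" by (simp add: comm)
  ultimately have "P * cnj_dqp P = Q * (?M * (cnj_dqp Q * ?M)) + Q * (?M * cnj_dqp R)
      + R * cnj_dqp Q * ?M + R * cnj_dqp R"
    by (simp add: distrib_left distrib_right mult.assoc)
  also have "\<dots> = (Q * cnj_dqp Q * ?M + Q * cnj_dqp R + R * cnj_dqp Q) * ?M + R * cnj_dqp R"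
    by (simp only: comm[of "cnj_dqp Q * ?M"] comm[of "cnj_dqp R"] distrib_right mult.assoc)
  also have "P * cnj_dqp P = dqp_of_real_poly N * ?M"
    by (simp only: norm dqp_of_real_poly_mult comm[of "dqp_of_real_poly N"])
  finally have "R * cnj_dqp R = X * ?M"
    by (simp add: X_def left_diff_distrib distrib_right)
  moreover have "R * cnj_dqp R = const_dqp (r1 * qcnj r1) * indet_dqp * indet_dqp
      + const_dqp (r1 * qcnj r0 + r0 * qcnj r1) * indet_dqp + const_dqp (r0 * qcnj r0)"
    unfolding R_def
    by (simp add: distrib_left distrib_right const_dqp_simps mult.assoc indet_const_commute add_ac)
  ultimately have XM: "X * ?M = const_dqp (r1 * qcnj r1) * indet_dqp * indet_dqp
      + const_dqp (r1 * qcnj r0 + r0 * qcnj r1) * indet_dqp + const_dqp (r0 * qcnj r0)"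
    by simp
  \<comment> \<open>As \<open>M\<close> is monic and \<open>X M\<close> has degree at most 2, \<open>X\<close> is a constant.\<close>
  have coeffs: "Poly_Mapping.lookup (X * ?M) i = (if i = 2 then r1 * qcnj r1 else 0)
      + (if i = 1 then r1 * qcnj r0 + r0 * qcnj r1 else 0) + (if i = 0 then r0 * qcnj r0 else 0)" for i
    unfolding XM by (auto simp: lookup_add lookup_mult_indet lookup_const_dqp split: nat.splits)
  have "Poly_Mapping.lookup X i = 0" if "1 \<le> i" for i
  proof (rule lookup_eq_0_descending[of 1 X i])
    fix j assume "1 \<le> j" "\<forall>l>j. Poly_Mapping.lookup X l = 0"
    then show "Poly_Mapping.lookup X j = 0"
      using lookup_mult_quadratic[of X c b "j + 2"] coeffs[of "j + 2"] by simp
  qed (use that in simp)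
  note high = this
  have X0: "Poly_Mapping.lookup X 0 = r1 * qcnj r1"
    using lookup_mult_quadratic[of X c b 2] coeffs[of 2] by (simp add: high)
  have "r1 * qcnj r0 + r0 * qcnj r1 = Poly_Mapping.lookup X 0 * of_real b"
    using lookup_mult_quadratic[of X c b 1] coeffs[of 1] by (simp add: high)
  with X0 show "r1 * qcnj r0 + r0 * qcnj r1 = r1 * qcnj r1 * of_real b" by simp
  have "r0 * qcnj r0 = Poly_Mapping.lookup X 0 * of_real c"
    using lookup_mult_quadratic[of X c b 0] coeffs[of 0] by simp
  with X0 show "r0 * qcnj r0 = r1 * qcnj r1 * of_real c" by simp
  show "dqp_of_real_poly N - Q * cnj_dqp Q * ?M
      - Q * cnj_dqp (const_dqp r1 * indet_dqp + const_dqp r0)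
      - (const_dqp r1 * indet_dqp + const_dqp r0) * cnj_dqp Q = const_dqp (r1 * qcnj r1)"
    unfolding R_def[symmetric] X_def[symmetric]
    by (rule poly_mapping_eqI) (simp add: lookup_const_dqp X0 high)
qed

lemma remainder_leading_nonzero:
  assumes norm: "P * cnj_dqp P = dqp_of_real_poly ([:c, b, 1:] * N)"
    and P: "P = Q * dqp_of_real_poly [:c, b, 1:] + const_dqp r1 * indet_dqp + const_dqp r0"
    and ndvd: "\<not> [:c, b, 1:] dvd N"
  shows "primal r1 \<noteq> 0"
proof
  \<comment> \<open>Then \<open>N = Q Q\<^sup>* M + Q R\<^sup>* + R Q\<^sup>*\<close>, where the last two terms are purely dual.\<close>
  assume r1: "primal r1 = 0"
  let ?M = "dqp_of_real_poly [:c, b, 1:]"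
  let ?R = "const_dqp r1 * indet_dqp + const_dqp r0"
  note rem = remainder_norm[OF norm P]
  have r11: "r1 * qcnj r1 = 0" using r1 by (simp add: primal_zero_mult)
  with rem(2) have "r0 * qcnj r0 = 0" by simp
  then have r0: "primal r0 = 0" by (metis primal_norm_eq_0 primal_zero)
  have right: "real_part_dqp (F * (const_dqp u * indet_dqp + const_dqp v)) = 0"
    if "primal u = 0" "primal v = 0" for F u v
  proof -
    have "primal (x * u) = 0" "primal (x * v) = 0" for x
      using that by (simp_all add: primal_mult)
    then have "Prim (Q1 (x * u)) = 0" "Prim (Q1 (x * v)) = 0" for x
      by (metis primal_sel(1) zero_quat.sel(1))+
    then show ?thesis
      by (intro poly_eqI)
        (simp add: coeff_real_part_dqp distrib_left lookup_add lookup_mult_indet lookup_mult_const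
          mult.assoc[symmetric] del: times_quat.sel split: nat.split)
  qed
  have cnj: "cnj_dqp (const_dqp u * indet_dqp + const_dqp v) =
      const_dqp (qcnj u) * indet_dqp + const_dqp (qcnj v)" for u v
    by (simp add: indet_commute)
  have left: "real_part_dqp ((const_dqp u * indet_dqp + const_dqp v) * F) = 0"
    if "primal u = 0" "primal v = 0" for F u v
  proof -
    have "real_part_dqp (cnj_dqp ((const_dqp u * indet_dqp + const_dqp v) * F)) = 0"
      unfolding cnj_dqp_mult cnj using that by (intro right) simp_all
    then show ?thesis by (simp only: real_part_dqp_cnj)
  qed
  have "dqp_of_real_poly N = Q * cnj_dqp Q * ?M + Q * cnj_dqp ?R + ?R * cnj_dqp Q"
    using rem(3) by (simp add: r11 const_dqp_simps algebra_simps)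
  then have "real_part_dqp (dqp_of_real_poly N) = real_part_dqp (Q * cnj_dqp Q) * [:c, b, 1:]
      + real_part_dqp (Q * cnj_dqp ?R) + real_part_dqp (?R * cnj_dqp Q)"
    by (simp only: real_part_dqp_add real_part_dqp_mult_real)
  also have "real_part_dqp (Q * cnj_dqp ?R) = 0"
    unfolding cnj using r0 r1 by (intro right) simp_all
  also have "real_part_dqp (?R * cnj_dqp Q) = 0" using r0 r1 by (intro left)
  finally have "real_part_dqp (dqp_of_real_poly N) = real_part_dqp (Q * cnj_dqp Q) * [:c, b, 1:]"
    by simp
  then have "N = real_part_dqp (Q * cnj_dqp Q) * [:c, b, 1:]" by simp
  with ndvd show False by (metis dvd_triv_right)
qed

lemma root_of_remainder:
  fixes r0 r1 :: dual_quat
  assumes r1: "primal r1 \<noteq> 0"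
    and eq1: "r1 * qcnj r0 + r0 * qcnj r1 = r1 * qcnj r1 * of_real b"
    and eq0: "r0 * qcnj r0 = r1 * qcnj r1 * of_real c"
  obtains h where "r0 = - (r1 * h)" "h + qcnj h = - of_real b" "h * qcnj h = of_real c"
proof -
  from r1 obtain s where s: "r1 * s = 1" "s * r1 = 1" by (rule dual_quat_invertible)
  have s': "qcnj r1 * qcnj s = 1"
    using arg_cong[OF s(2), of qcnj] by simp
  define h where "h = - (s * r0)"
  have r0: "r0 = - (r1 * h)"
    by (simp add: h_def s(1) flip: mult.assoc)
  \<comment> \<open>In terms of \<open>h\<close>, both equations have all terms between the units \<open>r\<^sub>1\<close> and \<open>r\<^sub>1\<^sup>*\<close>, which cancel.\<close>
  have cancel: "s * (r1 * x * qcnj r1) * qcnj s = x" for x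
    by (simp add: mult.assoc s s') (simp add: s flip: mult.assoc)
  have "r1 * (- (h + qcnj h)) * qcnj r1 = r1 * of_real b * qcnj r1"
    using eq1 by (simp add: r0 algebra_simps of_real_commute)
  then have "- (h + qcnj h) = of_real b" by (metis cancel)
  then have "h + qcnj h = - of_real b" by (metis minus_minus)
  moreover have "r1 * (h * qcnj h) * qcnj r1 = r1 * of_real c * qcnj r1"
    using eq0 by (simp add: r0 mult.assoc of_real_commute)
  then have "h * qcnj h = of_real c" by (metis cancel)
  ultimately show thesis using that r0 by blast
qed

lemma rotation_quat_if_irreducible:
  assumes tr: "h + qcnj h = - of_real b" and nm: "h * qcnj h = of_real c"
    and irr: "irreducible [:c, b, 1 :: real:]"
  shows "rotation_quat h"
proof -
  have "primal h \<notin> \<real>"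
  proof
    assume "primal h \<in> \<real>"
    then obtain p where p: "primal h = of_real p" by (rule Reals_cases)
    then have sel: "Prim (Q1 h) = p" "Prim (QI h) = 0" "Prim (QJ h) = 0" "Prim (QK h) = 0"
      by (simp_all flip: primal_sel)
    have "Prim (Q1 (h + qcnj h)) = - b" unfolding tr by simp
    moreover have "Prim 2 = 2" by (metis of_real_dual_number_sel(1) of_real_numeral)
    ultimately have "b = - 2 * p" by (simp add: sel)
    moreover have "Prim (Q1 (h * qcnj h)) = c" unfolding nm by simp
    then have "c = p * p" by (simp add: sel)
    ultimately have "[:c, b, 1:] = [:- p, 1:] * [:- p, 1:]" by simp
    with irr have "is_unit [:- p, 1 :: real:]"
      using irreducibleD by blast
    then show False by (simp add: is_unit_iff_degree)
  qed
  moreover from this have "h \<noteq> 0" by auto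
  moreover have "h * qcnj h \<in> \<real>" using nm by simp
  moreover have "h + qcnj h \<in> \<real>" unfolding tr by simp
  ultimately show ?thesis unfolding rotation_quat_def by blast
qed

lemma right_linear_factor:
  assumes norm: "P * cnj_dqp P = dqp_of_real_poly ([:c, b, 1:] * N)"
    and irr: "irreducible [:c, b, 1:]" and ndvd: "\<not> [:c, b, 1:] dvd N"
  obtains P' h where "rotation_quat h" "P = P' * (indet_dqp - const_dqp h)"
    "P' * cnj_dqp P' = dqp_of_real_poly N"
proof -
  let ?M = "dqp_of_real_poly [:c, b, 1:]"
  obtain Q r1 r0 where P: "P = Q * ?M + const_dqp r1 * indet_dqp + const_dqp r0"
    by (rule divide_quadratic)
  note rem = remainder_norm[OF norm P]
  from remainder_leading_nonzero[OF norm P ndvd] rem(1,2)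
  obtain h where h: "r0 = - (r1 * h)" "h + qcnj h = - of_real b" "h * qcnj h = of_real c"
    by (rule root_of_remainder)
  let ?L = "indet_dqp - const_dqp h" and ?L' = "indet_dqp - const_dqp (qcnj h)"
  have M1: "?L * ?L' = ?M" using h(2,3) by (rule quadratic_conj_factor)
  have M2: "?L' * ?L = ?M"
    using quadratic_conj_factor[of "qcnj h" b c] h(2,3) by (simp add: add.commute quat_norm_commute)
  define P' where "P' = Q * ?L' + const_dqp r1"
  have "P = P' * ?L"
    unfolding P'_def P M2[symmetric]
    by (simp add: h(1) const_dqp_simps algebra_simps)
  moreover have "(P' * cnj_dqp P') * ?M = dqp_of_real_poly N * ?M"
  proof -
    have "(P' * cnj_dqp P') * ?M = P' * ?M * cnj_dqp P'"
      by (simp only: mult.assoc dqp_of_real_poly_commute[of _ "cnj_dqp P'"])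
    also have "\<dots> = P * cnj_dqp P"
      by (simp add: \<open>P = P' * ?L\<close> mult.assoc flip: M1)
    also have "\<dots> = dqp_of_real_poly N * ?M"
      by (simp only: norm dqp_of_real_poly_mult
          dqp_of_real_poly_commute[of "[:c, b, 1:]" "dqp_of_real_poly N"])
    finally show ?thesis .
  qed
  then have "(P' * cnj_dqp P' - dqp_of_real_poly N) * ?M = 0"
    by (simp add: left_diff_distrib)
  then have "P' * cnj_dqp P' - dqp_of_real_poly N = 0"
    by (rule mult_quadratic_eq_0)
  then have "P' * cnj_dqp P' = dqp_of_real_poly N" by simp
  ultimately show thesis using that rotation_quat_if_irreducible[OF h(2,3) irr] by blast
qed

text \<open>
  For the induction, being monic of degree \<open>n\<close> is stated by coefficients, which also covers \<open>n = 0\<close>.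
\<close>

lemma factorization_of_distinct_quadratics:
  fixes P :: dq_poly
  assumes "Poly_Mapping.lookup P n = 1" "\<forall>i>n. Poly_Mapping.lookup P i = 0"
    and "finite S" "card S = n"
    and "\<And>M. M \<in> S \<Longrightarrow> lead_coeff M = 1 \<and> degree M = 2 \<and> irreducible M"
    and "P * cnj_dqp P = dqp_of_real_poly (\<Prod>S)"
  shows "\<exists>hs. length hs = n \<and> (\<forall>h\<in>set hs. rotation_quat h) \<and>
           P = prod_list (map (\<lambda>h. indet_dqp - const_dqp h) hs)"
  using assms
proof (induction n arbitrary: P S)
  case 0
  have "P = 1" by (rule poly_mapping_eqI) (use 0 in \<open>auto simp: lookup_one when_def\<close>)
  then show ?case by simp
next
  case (Suc n)
  from Suc.prems(4) obtain M where M: "M \<in> S" by (metis card.empty equals0I nat.distinct(1))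
  let ?S = "S - {M}"
  have mon: "lead_coeff M = 1" "degree M = 2" "irreducible M" using Suc.prems(5)[OF M] by auto
  obtain b c where Mbc: "M = [:c, b, 1:]" using mon(1,2) by (rule quadratic_coeffs)
  have "\<not> M dvd \<Prod>?S"
  proof (rule monic_irreducible_not_dvd_prod)
    show "lead_coeff N = 1 \<and> degree N = 2 \<and> irreducible N" if "N \<in> ?S" for N
      using Suc.prems(5) that by blast
  qed (use Suc.prems(3) mon in auto)
  moreover have "\<Prod>S = M * \<Prod>?S" using Suc.prems(3) M by (simp add: prod.remove)
  ultimately obtain P' h where h: "rotation_quat h" and P: "P = P' * (indet_dqp - const_dqp h)"
    and norm: "P' * cnj_dqp P' = dqp_of_real_poly (\<Prod>?S)"
    using right_linear_factor[of P c b "\<Prod>?S"] Suc.prems(6) mon(3) unfolding Mbc by metis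
  have coeffs: "Poly_Mapping.lookup P (Suc i) =
      Poly_Mapping.lookup P' i - Poly_Mapping.lookup P' (Suc i) * h" for i
    unfolding P by (rule lookup_mult_linear)
  have high: "Poly_Mapping.lookup P' i = 0" if "Suc n \<le> i" for i
  proof (rule lookup_eq_0_descending[of "Suc n"])
    fix j assume "Suc n \<le> j" "\<forall>l>j. Poly_Mapping.lookup P' l = 0"
    then show "Poly_Mapping.lookup P' j = 0" using coeffs[of j] Suc.prems(2) by simp
  qed (rule that)
  have top: "Poly_Mapping.lookup P' n = 1" using coeffs[of n] Suc.prems(1) high by simp
  have "\<exists>hs. length hs = n \<and> (\<forall>h\<in>set hs. rotation_quat h) \<and>
      P' = prod_list (map (\<lambda>h. indet_dqp - const_dqp h) hs)"
  proof (rule Suc.IH[OF top _ _ _ _ norm])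
    show "\<forall>i>n. Poly_Mapping.lookup P' i = 0" using high by simp
    show "lead_coeff N = 1 \<and> degree N = 2 \<and> irreducible N" if "N \<in> ?S" for N
      using Suc.prems(5) that by blast
  qed (use Suc.prems(3,4) M in simp_all)
  then obtain hs where "length hs = n" "\<forall>h\<in>set hs. rotation_quat h"
      "P' = prod_list (map (\<lambda>h. indet_dqp - const_dqp h) hs)" by blast
  then show ?case using h P by (intro exI[of _ "hs @ [h]"]) auto
qed

lemma lookup_above_degree_dqp:
  assumes "degree_dqp P < i"
  shows "Poly_Mapping.lookup P i = 0"
proof -
  have "\<forall>i>Max (Poly_Mapping.keys P). Poly_Mapping.lookup P i = 0"
    by (metis Max_ge finite_keys in_keys_iff linorder_not_le)
  then have "\<forall>i>degree_dqp P. Poly_Mapping.lookup P i = 0"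
    unfolding degree_dqp_def by (rule LeastI)
  with assms show ?thesis by blast
qed

theorem theorem3:
  fixes P :: dq_poly and n :: nat
  assumes "generic_motion_poly P" and "degree_dqp P = n" and "n > 0"
  shows "\<exists>hs :: dual_quat list. length hs = n \<and> (\<forall>h\<in>set hs. rotation_quat h) \<and>
           P = prod_list (map (\<lambda>h. indet_dqp - const_dqp h) hs)"
proof -
  from assms(1) obtain S where S: "finite S" "card S = degree_dqp P"
      "\<forall>M\<in>S. lead_coeff M = 1 \<and> degree M = 2 \<and> irreducible M"
      "P * cnj_dqp P = dqp_of_real_poly (\<Prod>S)"
    unfolding generic_motion_poly_def by blast
  have "Poly_Mapping.lookup P n = 1"
    using assms unfolding generic_motion_poly_def motion_poly_def monic_dqp_def by blast
  then show ?thesis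
    using S assms(2) by (intro factorization_of_distinct_quadratics)
      (auto simp: lookup_above_degree_dqp)
qed

end
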